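(* For all integers $t\ge 1$ and $k\ge 4$, $$A_2\bigl(k(t+1)+2,\,2k;\,k\bigr)=\frac{2^{k(t+1)+2}-3\cdot 2^{k}-1}{2^k-1}.$$
   Context: For a prime power $q$ and integers $1\le k\le n$, a partial $k$-spread in $\mathbb{F}_q^n$ is a set of $k$-dimensional subspaces of $\mathbb{F}_q^n$ any two of which intersect only in the zero vector. $A_q(n,2k;k)$ denotes the maximum possible number of elements of a partial $k$-spread in $\mathbb{F}_q^n$ (equivalently, the maximum size of a set of $k$-dimensional subspaces with pairwise subspace distance $\dim(U+V)-\dim(U\cap V)$ at least $2k$). *)

theory Defs
  imports Complex_Main "HOL-Library.Function_Algebras" "HOL-Library.Z2"
begin

text \<open>
  The space \<open>F\<^sup>n\<close> is represented as the set of the functions \<open>nat \<Rightarrow> F\<close> that vanish outside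
  \<open>{0..<n}\<close>, so that \<open>n\<close> is an ordinary natural number. The subspaces of \<open>F\<^sup>n\<close> are then exactly
  the subspaces of \<open>nat \<Rightarrow> F\<close> that are contained in this set. Addition on functions is the pointwise
  one of \<^theory>\<open>HOL-Library.Function_Algebras\<close>.
\<close>

definition fscale :: "'a::field \<Rightarrow> (nat \<Rightarrow> 'a) \<Rightarrow> nat \<Rightarrow> 'a" where
  "fscale c v = (\<lambda>i. c * v i)"

global_interpretation fvec: vector_space "fscale :: 'a::field \<Rightarrow> (nat \<Rightarrow> 'a) \<Rightarrow> nat \<Rightarrow> 'a"
  by standard (auto simp: fscale_def fun_eq_iff algebra_simps)

definition fspace :: "nat \<Rightarrow> (nat \<Rightarrow> 'a::field) set" where
  "fspace n = {v. \<forall>i\<ge>n. v i = 0}"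

lemma dim_fspace: "fvec.dim (fspace n :: (nat \<Rightarrow> 'a::field) set) = n"
proof -
  let ?e = "\<lambda>i j. if j = i then 1 else (0::'a)"
  let ?B = "?e ` {..<n}"
  have inj: "inj_on ?e {..<n}" by (auto simp: inj_on_def fun_eq_iff split: if_splits)
  have val: "(\<Sum>v\<in>?B. fscale (u v) v) j = (if j < n then u (?e j) else 0)" for u j
  proof -
    have "(\<Sum>v\<in>?B. fscale (u v) v) = (\<Sum>i<n. fscale (u (?e i)) (?e i))"
      by (rule sum.reindex_cong[OF inj refl refl])
    moreover have "(\<Sum>i\<in>A. fscale (u (?e i)) (?e i)) j = (if j \<in> A then u (?e j) else 0)" if "finite A" for A
      using that by (induction A) (auto simp: fscale_def)
    ultimately show ?thesis by auto
  qed
  have ind: "fvec.independent ?B"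
  proof
    assume "fvec.dependent ?B"
    then obtain u v where uv: "v \<in> ?B" "u v \<noteq> 0" "(\<Sum>v\<in>?B. fscale (u v) v) = 0"
      using fvec.dependent_finite[of ?B] by auto
    then obtain i where "i < n" "v = ?e i" by auto
    with uv val[of u i] show False by auto
  qed
  have "fspace n \<subseteq> fvec.span ?B"
  proof
    fix v :: "nat \<Rightarrow> 'a" assume v: "v \<in> fspace n"
    have "v = (\<Sum>w\<in>?B. fscale (v (inv_into {..<n} ?e w)) w)"
    proof
      fix j show "v j = (\<Sum>w\<in>?B. fscale (v (inv_into {..<n} ?e w)) w) j"
        unfolding val using v inv_into_f_f[OF inj, of j] by (auto simp: fspace_def)
    qed
    also have "\<dots> \<in> fvec.span ?B" by (intro fvec.span_sum fvec.span_scale fvec.span_base)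
    finally show "v \<in> fvec.span ?B" .
  qed
  moreover have "?B \<subseteq> fspace n" by (auto simp: fspace_def)
  moreover have "card ?B = n" using inj by (simp add: card_image)
  ultimately show ?thesis using ind by (intro fvec.dim_unique)
qed

definition partial_spread :: "nat \<Rightarrow> nat \<Rightarrow> (nat \<Rightarrow> 'a::field) set set \<Rightarrow> bool" where
  "partial_spread n k S \<longleftrightarrow>
     (\<forall>U\<in>S. fvec.subspace U \<and> U \<subseteq> fspace n \<and> fvec.dim U = k) \<and>
     (\<forall>U\<in>S. \<forall>W\<in>S. U \<noteq> W \<longrightarrow> U \<inter> W = {0})"

text \<open>
  \<open>max_partial_spread TYPE('a) n k\<close> is \<open>A\<^sub>q(n, 2k; k)\<close> for the finite field \<open>'a\<close> with \<open>q\<close> elements.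
  By \<open>finite_partial_spreads\<close> and \<open>partial_spread_empty\<close> below, the maximum is taken over a finite
  nonempty set; by \<open>finite_partial_spread\<close>, no infinite spread contributes the default cardinality
  \<open>0\<close>.
\<close>

definition max_partial_spread :: "'a::{field,finite} itself \<Rightarrow> nat \<Rightarrow> nat \<Rightarrow> nat" where
  "max_partial_spread _ n k = Max {card S | S :: (nat \<Rightarrow> 'a) set set. partial_spread n k S}"

lemma finite_fspace: "finite (fspace n :: (nat \<Rightarrow> 'a::{field,finite}) set)"
proof (rule finite_subset)
  show "(fspace n :: (nat \<Rightarrow> 'a) set) \<subseteq>
      {f. (\<forall>x. (x \<in> {..<n} \<longrightarrow> f x \<in> UNIV) \<and> (x \<notin> {..<n} \<longrightarrow> f x = 0))}"
    by (auto simp: fspace_def)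
  show "finite {f :: nat \<Rightarrow> 'a. (\<forall>x. (x \<in> {..<n} \<longrightarrow> f x \<in> UNIV) \<and> (x \<notin> {..<n} \<longrightarrow> f x = 0))}"
    by (rule finite_set_of_finite_funs) auto
qed

lemma partial_spread_subset: "partial_spread n k S \<Longrightarrow> S \<subseteq> Pow (fspace n)"
  by (auto simp: partial_spread_def)

lemma finite_partial_spread:
  fixes S :: "(nat \<Rightarrow> 'a::{field,finite}) set set"
  shows "partial_spread n k S \<Longrightarrow> finite S"
  by (meson finite_Pow_iff finite_fspace finite_subset partial_spread_subset)

lemma finite_partial_spreads:
  "finite {card S | S :: (nat \<Rightarrow> 'a::{field,finite}) set set. partial_spread n k S}"
proof (rule finite_subset)
  show "{card S | S :: (nat \<Rightarrow> 'a) set set. partial_spread n k S}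
      \<subseteq> card ` Pow (Pow (fspace n :: (nat \<Rightarrow> 'a) set))"
    using partial_spread_subset by blast
qed (simp add: finite_fspace)

lemma partial_spread_empty: "partial_spread n k {}"
  by (simp add: partial_spread_def)

lemma UNIV_bit: "UNIV = {0, 1 :: bit}"
  by (auto intro: bit.exhaust)

instance bit :: finite
  by standard (simp add: UNIV_bit)

lemma card_bit: "card (UNIV :: bit set) = 2"
  by (simp add: UNIV_bit)

end

theory Submission
  imports Defs "HOL-Library.Cardinality" "HOL-Number_Theory.Cong" "HOL-Algebra.Algebraic_Closure_Type"
begin

text \<open>
  Upper bound: a spread with one element more than claimed has \<open>2 ^ (k + 1) + 1\<close> holes (nonzero
  vectors covered by no element), and every subspace of codimension \<open>j \<le> k\<close> contains a number of
  holes that is \<open>1\<close> modulo \<open>2 ^ (k - j)\<close>. A subspace with \<open>h > 0\<close> holes has, by averaging, a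
  hyperplane with fewer than \<open>h / 2\<close> of them. Three descents and the congruences bound the number of
  holes by \<open>2 ^ (k - 1) + 1\<close>, then \<open>1\<close>, then \<open>0\<close>, and \<open>0\<close> is not \<open>1\<close> modulo \<open>2 ^ (k - 3)\<close> as
  \<open>k \<ge> 4\<close>.

  Lower bound: multiplication in the field with \<open>2 ^ m\<close> elements gives the \<open>2 ^ m\<close> pairwise disjoint
  graphs of the maps \<open>x \<mapsto> a x\<close> on a \<open>k\<close>-dimensional subspace, all disjoint from \<open>F\<^sup>m\<close>. They extend
  a partial spread in \<open>F\<^sup>m\<close> to one in \<open>F\<^sup>m\<^sup>+\<^sup>k\<close>.
\<close>

section \<open>Cardinalities of subspaces over a finite field\<close>

declare add_bit_eq_xor [simp del] mult_bit_eq_and [simp del]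

lemma fvec_bit_add_self: "v + v = (0 :: nat \<Rightarrow> bit)"
  by (auto simp: fun_eq_iff)

text \<open>Scalars in \<open>bit\<close> are only 0 and 1, so closure under scaling reduces to
  containing 0.\<close>

lemma subspace_bit_iff:
  "fvec.subspace (U :: (nat \<Rightarrow> bit) set) \<longleftrightarrow> 0 \<in> U \<and> (\<forall>x\<in>U. \<forall>y\<in>U. x + y \<in> U)"
proof -
  have "fscale c x = (if c = 0 then 0 else x)" for c :: bit and x
    by (auto simp: fscale_def fun_eq_iff)
  thus ?thesis
    by (auto simp: fvec.subspace_def)
qed

text \<open>Each new independent vector multiplies the size of the span by \<open>CARD('a)\<close>.
  The scaling is arbitrary because both \<open>nat \<Rightarrow> bit\<close> and
  \<open>bit alg_closure\<close> are counted this way.\<close>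

lemma card_span:
  fixes scale :: "'a::{field,finite} \<Rightarrow> 'b::ab_group_add \<Rightarrow> 'b"
  assumes "vector_space scale" "finite B" "\<not> module.dependent scale B"
  shows "finite (module.span scale B) \<and> card (module.span scale B) = CARD('a) ^ card B"
proof -
  interpret vector_space scale by fact
  show ?thesis
    using assms(2,3)
  proof (induction B rule: finite_induct)
    case (insert a B)
    have a: "a \<notin> span B" and ind: "independent B"
      using insert.hyps insert.prems by (auto simp: independent_insert)
    let ?f = "\<lambda>(c, y). y + scale c a"
    have "span (insert a B) = ?f ` (UNIV \<times> span B)"
    proof (intro equalityI subsetI)
      fix x assume "x \<in> span (insert a B)"
      then obtain c where "x - scale c a \<in> span B"
        by (auto simp: span_breakdown_eq)
      thus "x \<in> ?f ` (UNIV \<times> span B)"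
        by (intro image_eqI[of _ _ "(c, x - scale c a)"]) auto
    next
      fix x assume "x \<in> ?f ` (UNIV \<times> span B)"
      thus "x \<in> span (insert a B)"
        by (auto simp: span_breakdown_eq) (metis add_diff_cancel_right')
    qed
    \<comment> \<open>Two representations with different coefficients could be solved for
      \<open>a\<close>, placing it in the span of \<open>B\<close>.\<close>
    moreover have "inj_on ?f (UNIV \<times> span B)"
    proof (rule inj_onI, clarify)
      fix c y d z assume y: "y \<in> span B" and z: "z \<in> span B"
        and eq: "y + scale c a = z + scale d a"
      have eq': "scale (c - d) a = z - y"
        using eq by (simp add: scale_left_diff_distrib algebra_simps)
      have "c = d"
      proof (rule ccontr)
        assume "c \<noteq> d"
        hence "a = scale (inverse (c - d)) (z - y)"
          by (simp flip: eq')
        thus False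
          using a y z by (metis span_diff span_scale)
      qed
      with eq show "c = d \<and> y = z" by simp
    qed
    ultimately show ?case
      using insert.IH[OF ind] insert.hyps by (simp add: card_image card_cartesian_product)
  qed simp
qed

lemma card_subspace:
  fixes U :: "(nat \<Rightarrow> 'a::{field,finite}) set"
  assumes "fvec.subspace U" "finite U"
  shows "card U = CARD('a) ^ fvec.dim U"
proof -
  obtain B where B: "B \<subseteq> U" "fvec.independent B" "U \<subseteq> fvec.span B" "card B = fvec.dim U"
    using fvec.basis_exists by blast
  have "fvec.span B = U"
    using B assms by (meson fvec.span_minimal subset_antisym)
  moreover have "finite B"
    using B assms finite_subset by blast
  ultimately show ?thesis
    using card_span[OF fvec.vector_space_axioms \<open>finite B\<close> B(2)] B(4) by auto
qed

lemma subspace_fspace: "fvec.subspace (fspace n)"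
  by (auto simp: fvec.subspace_def fspace_def fscale_def)

lemma card_fspace: "card (fspace n :: (nat \<Rightarrow> 'a::{field,finite}) set) = CARD('a) ^ n"
  using card_subspace[OF subspace_fspace finite_fspace] by (simp add: dim_fspace)

lemma fspace_mono: "m \<le> n \<Longrightarrow> fspace m \<subseteq> fspace n"
  by (auto simp: fspace_def)

subsection \<open>Averaging over hyperplanes\<close>

lemma subspace_kernel_bit:
  fixes f :: "(nat \<Rightarrow> bit) \<Rightarrow> bit"
  assumes "fvec.subspace U" "\<And>x y. f (x + y) = f x + f y"
  shows "fvec.subspace {x\<in>U. f x = 0}"
proof -
  have "f 0 = 0"
    using assms(2)[of 0 0] by simp
  thus ?thesis
    using assms by (auto simp: subspace_bit_iff)
qed

text \<open>Translation by \<open>u\<close> exchanges the two fibres of \<open>f\<close>, so both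
  have the same size.\<close>

lemma card_kernel_bit:
  fixes f :: "(nat \<Rightarrow> bit) \<Rightarrow> bit"
  assumes "fvec.subspace U" "finite U" "\<And>x y. f (x + y) = f x + f y" "u \<in> U" "f u = 1"
  shows "card U = 2 * card {x\<in>U. f x = 0}"
proof -
  have "bij_betw (\<lambda>x. x + u) {x\<in>U. f x = 0} {x\<in>U. f x = 1}"
    by (rule bij_betw_byWitness[where f' = "\<lambda>x. x + u"])
       (use assms in \<open>auto simp: subspace_bit_iff add.assoc fvec_bit_add_self\<close>)
  hence eq: "card {x\<in>U. f x = 1} = card {x\<in>U. f x = 0}"
    by (simp add: bij_betw_same_card)
  have "U = {x\<in>U. f x = 0} \<union> {x\<in>U. f x = 1}"
    by auto
  hence "card U = card ({x\<in>U. f x = 0} \<union> {x\<in>U. f x = 1})"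
    by simp
  also have "\<dots> = card {x\<in>U. f x = 0} + card {x\<in>U. f x = 1}"
    by (rule card_Un_disjoint) (use assms in auto)
  finally show ?thesis
    using eq by simp
qed

text \<open>The kernel is either half of \<open>U\<close> or all of it, so at most one factor 2 is
  lost.\<close>

lemma dvd_card_kernel_bit:
  fixes f :: "(nat \<Rightarrow> bit) \<Rightarrow> bit"
  assumes "fvec.subspace U" "finite U" "\<And>x y. f (x + y) = f x + f y" "2 ^ Suc m dvd card U"
  shows "2 ^ m dvd card {x\<in>U. f x = 0}"
proof (cases "\<exists>u\<in>U. f u = 1")
  case True
  then obtain u where "u \<in> U" "f u = 1"
    by auto
  from card_kernel_bit[OF assms(1-3) this] show ?thesis
    using assms(4) by simp
next
  case False
  hence "{x\<in>U. f x = 0} = U"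
    by auto
  thus ?thesis
    using assms(4) by (metis dvd_trans le_SucI le_imp_power_dvd order_refl)
qed

definition dot :: "nat \<Rightarrow> (nat \<Rightarrow> bit) \<Rightarrow> (nat \<Rightarrow> bit) \<Rightarrow> bit" where
  "dot n a x = (\<Sum>i<n. a i * x i)"

lemma dot_add: "dot n a (x + y) = dot n a x + dot n a y"
  by (simp add: dot_def distrib_left sum.distrib)

lemma dot_commute: "dot n a x = dot n x a"
  by (simp add: dot_def mult.commute)

lemma dot_unit: "j < n \<Longrightarrow> dot n x (\<lambda>i. if i = j then 1 else 0) = x j"
  by (simp add: dot_def if_distrib cong: if_cong)

text \<open>By symmetry of \<open>dot\<close> this set is the kernel of an additive map, which is 1
  on the unit vector at a coordinate where \<open>x\<close> is 1.\<close>

lemma card_orthogonal: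
  assumes "x \<in> fspace n - {0}"
  shows "2 * card {a\<in>fspace n. dot n a x = 0} = 2 ^ n"
proof -
  from assms obtain j where j: "j < n" "x j = 1"
    by (auto simp: fspace_def fun_eq_iff) (metis leI bit_not_zero_iff)
  let ?u = "\<lambda>i. if i = j then 1 else (0::bit)"
  have "card (fspace n :: (nat \<Rightarrow> bit) set) = 2 * card {a\<in>fspace n. dot n x a = 0}"
    by (rule card_kernel_bit[OF subspace_fspace finite_fspace dot_add, where u = ?u])
       (use j in \<open>auto simp: fspace_def dot_unit\<close>)
  thus ?thesis
    by (simp add: card_fspace card_bit dot_commute[of n x])
qed

text \<open>Double counting of orthogonal pairs: every nonzero \<open>x\<close> is orthogonal to
  half of all \<open>a\<close>, so on average over \<open>a\<close> exactly half of \<open>H\<close>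
  survives.\<close>

lemma exists_hyperplane_few:
  assumes "H \<subseteq> fspace n - {0}" "H \<noteq> {}"
  obtains a where "2 * card {x\<in>H. dot n a x = 0} < card H"
proof -
  let ?A = "fspace n :: (nat \<Rightarrow> bit) set"
  have fin: "finite H"
    using assms finite_fspace by (metis finite_Diff finite_subset)
  have "\<exists>a. 2 * card {x\<in>H. dot n a x = 0} < card H"
  proof (rule ccontr)
    assume *: "\<not> ?thesis"
    have "(\<Sum>a\<in>?A. card H) < (\<Sum>a\<in>?A. 2 * card {x\<in>H. dot n a x = 0})"
    proof (rule sum_strict_mono_ex1)
      \<comment> \<open>The choice \<open>a = 0\<close> keeps all of \<open>H\<close> and lies above
        the average, which makes the inequality for some other \<open>a\<close> strict.\<close>
      show "\<exists>a\<in>?A. card H < 2 * card {x\<in>H. dot n a x = 0}"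
        by (rule bexI[of _ 0]) (use fin assms(2) in \<open>auto simp: dot_def fspace_def card_gt_0_iff\<close>)
    qed (use * finite_fspace in \<open>auto simp: not_less\<close>)
    also have "\<dots> = 2 * (\<Sum>a\<in>?A. card {x\<in>H. dot n a x = 0})"
      by (simp add: sum_distrib_left)
    also have "(\<Sum>a\<in>?A. card {x\<in>H. dot n a x = 0}) = (\<Sum>x\<in>H. card {a\<in>?A. dot n a x = 0})"
      using sum.swap_restrict[OF finite_fspace fin, of "\<lambda>_ _. 1::nat" "\<lambda>a x. dot n a x = 0"]
      by simp
    also have "2 * \<dots> = (\<Sum>x\<in>H. 2 * card {a\<in>?A. dot n a x = 0})"
      by (simp add: sum_distrib_left)
    also have "\<dots> = (\<Sum>x\<in>H. 2 ^ n)"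
      by (intro sum.cong refl card_orthogonal) (use assms in auto)
    also have "\<dots> = (\<Sum>a\<in>?A. card H)"
      by (simp add: card_fspace card_bit)
    finally show False
      by simp
  qed
  with that show thesis
    by blast
qed

subsection \<open>The holes of a partial spread\<close>

text \<open>The nonzero vectors of \<open>U\<close> are the holes and the disjoint sets
  \<open>Y \<inter> U - {0}\<close>. The terms \<open>1\<close> and \<open>card S\<close> account
  for the zero vectors and avoid subtraction in \<open>nat\<close>.\<close>

lemma card_holes:
  assumes S: "partial_spread n k (S :: (nat \<Rightarrow> bit) set set)"
    and U: "fvec.subspace U" "U \<subseteq> fspace n"
  shows "card (U - {0} - \<Union>S) + (\<Sum>Y\<in>S. card (Y \<inter> U)) + 1 = card U + card S"
proof -
  have finU: "finite U"
    using U finite_fspace finite_subset by blast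
  have finS: "finite S"
    using S by (rule finite_partial_spread)
  have 0: "0 \<in> U" "\<And>Y. Y \<in> S \<Longrightarrow> 0 \<in> Y"
    using U S by (auto simp: partial_spread_def fvec.subspace_def)
  let ?C = "\<Union>Y\<in>S. Y \<inter> U - {0}"
  have "card ?C = (\<Sum>Y\<in>S. card (Y \<inter> U - {0}))"
    by (rule card_UN_disjoint) (use finU finS S in \<open>auto simp: partial_spread_def, blast+\<close>)
  moreover have "card (Y \<inter> U) = card (Y \<inter> U - {0}) + 1" if "Y \<in> S" for Y
    using card.remove[of "Y \<inter> U" 0] finU 0 that by simp
  hence "(\<Sum>Y\<in>S. card (Y \<inter> U)) = (\<Sum>Y\<in>S. card (Y \<inter> U - {0}) + 1)"
    by (intro sum.cong refl)
  hence "(\<Sum>Y\<in>S. card (Y \<inter> U)) = (\<Sum>Y\<in>S. card (Y \<inter> U - {0})) + card S"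
    by (simp only: sum.distrib sum_constant mult_1_right of_nat_id)
  moreover have "card U = card (U - {0}) + 1"
    using card.remove[of U 0] finU 0 by simp
  moreover have "U - {0} = (U - {0} - \<Union>S) \<union> ?C"
    by auto
  hence "card (U - {0}) = card ((U - {0} - \<Union>S) \<union> ?C)"
    by simp
  hence "card (U - {0}) = card (U - {0} - \<Union>S) + card ?C"
    by (subst (asm) card_Un_disjoint) (use finU finS in auto)
  ultimately show ?thesis
    by simp
qed

text \<open>
  Subspaces of codimension at most \<open>k - m\<close> satisfy the following condition for a partial
  \<open>k\<close>-spread. It is stated through divisibility so that a descent step need not know whether a
  hyperplane section is proper.
\<close>

definition divisible_section :: "nat \<Rightarrow> nat \<Rightarrow> (nat \<Rightarrow> bit) set set \<Rightarrow> (nat \<Rightarrow> bit) set \<Rightarrow> bool" where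
  "divisible_section n m S U \<longleftrightarrow> fvec.subspace U \<and> U \<subseteq> fspace n \<and> 2 ^ m dvd card U \<and>
     (\<forall>Y\<in>S. 2 ^ m dvd card (Y \<inter> U))"

text \<open>Modulo \<open>2 ^ m\<close> the counting identity shrinks to \<open>h + 1 = 2\<close>,
  where \<open>h\<close> is the number of holes.\<close>

lemma card_holes_mod:
  assumes "partial_spread n k S" "divisible_section n m S U" "[card S = 2] (mod 2 ^ m)"
  shows "[card (U - {0} - \<Union>S) = 1] (mod 2 ^ m)"
proof -
  let ?h = "card (U - {0} - \<Union>S)"
  have eq: "?h + (\<Sum>Y\<in>S. card (Y \<inter> U)) + 1 = card U + card S"
    using assms by (intro card_holes) (auto simp: divisible_section_def)
  have "[(\<Sum>Y\<in>S. card (Y \<inter> U)) = 0] (mod 2 ^ m)"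
    using assms by (auto simp: divisible_section_def cong_0_iff intro!: dvd_sum)
  hence "[?h + (\<Sum>Y\<in>S. card (Y \<inter> U)) + 1 = ?h + 0 + 1] (mod 2 ^ m)"
    by (intro cong_add cong_refl)
  moreover have "[card U + card S = 0 + 2] (mod 2 ^ m)"
    using assms by (intro cong_add) (auto simp: divisible_section_def cong_0_iff)
  ultimately have "[?h + 1 = 1 + 1] (mod 2 ^ m)"
    by (simp only: eq cong_def add_0 add.right_neutral one_add_one)
  thus ?thesis
    by (simp only: cong_add_rcancel_nat)
qed

text \<open>\<open>W\<close> is the hyperplane section of \<open>U\<close> found by averaging; every
  cardinality in the divisibility condition loses at most one factor 2.\<close>

lemma divisible_section_descent:
  assumes "partial_spread n k S" "divisible_section n (Suc m) S U" "[card S = 2] (mod 2 ^ Suc m)"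
  obtains W where "divisible_section n m S W"
    "2 * card (W - {0} - \<Union>S) < card (U - {0} - \<Union>S)"
proof -
  let ?H = "U - {0} - \<Union>S"
  have U: "fvec.subspace U" "U \<subseteq> fspace n"
    using assms(2) by (auto simp: divisible_section_def)
  have finU: "finite U"
    using U finite_fspace finite_subset by blast
  \<comment> \<open>Averaging needs a hole to exist; the congruence supplies one because the modulus
    is at least 2.\<close>
  have "?H \<noteq> {}"
  proof
    assume "?H = {}"
    with card_holes_mod[OF assms] have "[0 = 1::nat] (mod 2 ^ Suc m)"
      by (simp only: card.empty)
    thus False
      by (simp add: cong_def)
  qed
  moreover have "?H \<subseteq> fspace n - {0}"
    using U by auto
  ultimately obtain a where a: "2 * card {x\<in>?H. dot n a x = 0} < card ?H"
    using exists_hyperplane_few[of ?H n] by auto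
  let ?W = "{x\<in>U. dot n a x = 0}"
  have "divisible_section n m S ?W"
    unfolding divisible_section_def
  proof (intro conjI ballI)
    show "fvec.subspace ?W"
      by (rule subspace_kernel_bit[OF U(1) dot_add])
    show "2 ^ m dvd card ?W"
      using assms(2) by (intro dvd_card_kernel_bit U finU dot_add) (simp add: divisible_section_def)
    fix Y assume Y: "Y \<in> S"
    have "2 ^ m dvd card {x \<in> Y \<inter> U. dot n a x = 0}"
      using assms Y finU
      by (intro dvd_card_kernel_bit fvec.subspace_inter dot_add)
         (auto simp: divisible_section_def partial_spread_def)
    also have "{x \<in> Y \<inter> U. dot n a x = 0} = Y \<inter> ?W"
      by auto
    finally show "2 ^ m dvd card (Y \<inter> ?W)" .
  qed (use U in auto)
  moreover have "{x\<in>?H. dot n a x = 0} = ?W - {0} - \<Union>S"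
    by auto
  hence "2 * card (?W - {0} - \<Union>S) < card ?H"
    using a by simp
  ultimately show thesis
    by (rule that)
qed

text \<open>Members of the residue class are \<open>d\<close> apart, so a strict bound at one of
  them drops to the preceding one. This sharpens the bound obtained by halving.\<close>

lemma cong_1_less_imp_le:
  assumes "[x = 1] (mod d)" "x < c * d + 1" "c > 0"
  shows "x \<le> (c - 1) * d + (1::nat)"
proof (cases "x = 0")
  case False
  hence "d dvd x - 1"
    using assms(1) by (metis One_nat_def Suc_leI cong_altdef_nat cong_sym neq0_conv)
  then obtain e where e: "x - 1 = d * e" ..
  with False assms(2) have "d * e < d * c"
    by (simp only: mult.commute[of c])
  hence "e \<le> c - 1"
    by auto
  hence "d * e \<le> (c - 1) * d"
    by (simp add: mult.commute)
  with e show ?thesis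
    by linarith
qed simp

text \<open>Here \<open>k = m + 4\<close>, so that after three descents the modulus
  \<open>2 ^ (m + 1)\<close> is still at least 2 and excludes 0 holes.\<close>

lemma no_divisible_section:
  assumes S: "partial_spread n k S" "[card S = 2] (mod 2 ^ (m + 4))"
    and U: "divisible_section n (m + 4) S U" "card (U - {0} - \<Union>S) = 2 ^ (m + 5) + 1"
  shows False
proof -
  let ?h = "\<lambda>U. card (U - {0} - \<Union>S)"
  have S': "[card S = 2] (mod 2 ^ l)" if "l \<le> m + 4" for l
    using S(2) le_imp_power_dvd[OF that] by (rule cong_dvd_modulus_nat)
  have Suc: "Suc (m + 1) = m + 2" "Suc (m + 2) = m + 3" "Suc (m + 3) = m + 4"
    by simp_all
  obtain U1 where U1: "divisible_section n (m + 3) S U1" "2 * ?h U1 < ?h U"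
    using divisible_section_descent[of n k S "m + 3" U, unfolded Suc, OF S(1) U(1) S'] by auto
  have "?h U1 \<le> (2 - 1) * 2 ^ (m + 3) + 1"
  proof (rule cong_1_less_imp_le[OF card_holes_mod[OF S(1) U1(1) S']])
    \<comment> \<open>Halving \<open>2 ^ (m + 5) + 1\<close> leaves at most
      \<open>2 ^ (m + 4)\<close>, just below the third member of the residue class.\<close>
    show "?h U1 < 2 * 2 ^ (m + 3) + 1"
      using U1(2) U(2) by (simp add: power_add)
  qed auto
  moreover obtain U2 where U2: "divisible_section n (m + 2) S U2" "2 * ?h U2 < ?h U1"
    using divisible_section_descent[of n k S "m + 2" U1, unfolded Suc, OF S(1) U1(1) S'] by auto
  ultimately have lt: "?h U2 < 1 * 2 ^ (m + 2) + 1"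
    by (simp add: power_add)
  have "?h U2 \<le> (1 - 1) * 2 ^ (m + 2) + 1"
    by (rule cong_1_less_imp_le[OF card_holes_mod[OF S(1) U2(1) S'] lt]) auto
  moreover obtain U3 where U3: "divisible_section n (m + 1) S U3" "2 * ?h U3 < ?h U2"
    using divisible_section_descent[of n k S "m + 1" U2, unfolded Suc, OF S(1) U2(1) S'] by auto
  ultimately have "?h U3 = 0"
    by simp
  with card_holes_mod[OF S(1) U3(1) S'] show False
    by (simp add: cong_def)
qed

subsection \<open>The maximum as a recursive sum\<close>

text \<open>The value for ambient dimension \<open>k * (t + 1) + 2\<close>. The power of two in the
  recursion is the number of graphs added by one lift from dimension
  \<open>k * Suc t + 2\<close>.\<close>

fun spread_size :: "nat \<Rightarrow> nat \<Rightarrow> nat" where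
  "spread_size k 0 = 1"
| "spread_size k (Suc t) = 2 ^ (k * Suc t + 2) + spread_size k t"

text \<open>The closed form with its denominator cleared and all negative terms moved across, so
  that it can be proved in \<open>nat\<close>.\<close>

lemma spread_size_eq:
  "spread_size k t * 2 ^ k + 3 * 2 ^ k + 1 = 2 ^ (k * (t + 1) + 2) + spread_size k t"
  by (induction t) (simp_all add: algebra_simps power_add)

lemma spread_size_mod: "[spread_size k t = 1] (mod 2 ^ k)"
proof (induction t)
  case (Suc t)
  have "[(2::nat) ^ (k * Suc t + 2) = 0] (mod 2 ^ k)"
    by (simp add: cong_0_iff power_add)
  from cong_add[OF this Suc] show ?case
    by simp
qed simp

lemma partial_spread_le:
  assumes "partial_spread (k * (t + 1) + 2) k (S :: (nat \<Rightarrow> bit) set set)" "k \<ge> 4"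
  shows "card S \<le> spread_size k t"
proof (rule ccontr)
  let ?n = "k * (t + 1) + 2" and ?U = "fspace (k * (t + 1) + 2) :: (nat \<Rightarrow> bit) set"
  assume "\<not> ?thesis"
  \<comment> \<open>An exact size is needed: it fixes both the residue 2 and the number of
    holes.\<close>
  then obtain T where T: "T \<subseteq> S" "card T = spread_size k t + 1"
    using obtain_subset_with_card_n[of "spread_size k t + 1" S] by auto
  have spread: "partial_spread ?n k T"
    using assms T unfolding partial_spread_def by (meson subsetD)
  have cong: "[card T = 2] (mod 2 ^ k)"
    using cong_add[OF spread_size_mod[of k t] cong_refl[of 1]] T by (simp add: eval_nat_numeral)
  have card: "card (Y \<inter> ?U) = 2 ^ k" if "Y \<in> T" for Y
  proof -
    have "fvec.subspace Y" "Y \<subseteq> ?U" "fvec.dim Y = k"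
      using spread that by (auto simp: partial_spread_def)
    thus ?thesis
      using card_subspace[of Y] finite_subset[OF _ finite_fspace]
      by (metis card_bit inf.absorb1)
  qed
  have "divisible_section ?n k T ?U"
    using card by (auto simp: divisible_section_def subspace_fspace card_fspace card_bit power_add)
  \<comment> \<open>With \<open>s = spread_size k t\<close> the count is
    \<open>2 ^ ?n + s - (s + 1) * 2 ^ k\<close>, and \<open>spread_size_eq\<close> evaluates it to
    \<open>3 * 2 ^ k + 1 - 2 ^ k\<close>.\<close>
  moreover have "card (?U - {0} - \<Union>T) = 2 ^ (k + 1) + 1"
  proof -
    have "(\<Sum>Y\<in>T. card (Y \<inter> ?U)) = card T * 2 ^ k"
      using card by simp
    thus ?thesis
      using card_holes[OF spread subspace_fspace order_refl] spread_size_eq[of k t] T(2)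
      by (simp add: card_fspace card_bit)
  qed
  ultimately show False
    using no_divisible_section[OF spread, of "k - 4" ?U] cong assms(2) by simp
qed

subsection \<open>Multiplication on binary vectors\<close>

text \<open>Over an algebraically closed field \<open>p\<close> splits into linear factors; a
  repeated factor would make its root a root of \<open>pderiv p\<close> too.\<close>

lemma card_roots_separable:
  fixes p :: "'a::alg_closed_field poly"
  assumes "p \<noteq> 0" and sep: "\<And>x. poly p x = 0 \<Longrightarrow> poly (pderiv p) x \<noteq> 0"
  shows "card {x. poly p x = 0} = degree p"
proof -
  obtain A where A: "size A = degree p" "p = smult (lead_coeff p) (\<Prod>x\<in>#A. [:-x, 1:])"
    using alg_closed_imp_factorization[OF assms(1)] by blast
  have lc: "lead_coeff p \<noteq> 0"
    using assms(1) by simp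
  have roots: "poly p x = 0 \<longleftrightarrow> x \<in># A" for x
    by (subst A(2)) (use lc in \<open>auto simp: poly_prod_mset prod_mset_zero_iff\<close>)
  have "count A x = 1" if x: "x \<in># A" for x
  proof (rule ccontr)
    assume "count A x \<noteq> 1"
    with x obtain B where B: "A = add_mset x B" "x \<in># B"
      by (metis count_add_mset count_eq_zero_iff insert_DiffM One_nat_def)
    then obtain C where "A = add_mset x (add_mset x C)"
      by (metis insert_DiffM)
    hence p: "p = smult (lead_coeff p) ([:-x, 1:] * ([:-x, 1:] * (\<Prod>x\<in>#C. [:-x, 1:])))"
      using A(2) by simp
    have "poly (pderiv p) x = 0"
      by (subst p) (simp add: pderiv_smult pderiv_mult del: mult_pCons_left)
    with sep roots x show False
      by auto
  qed
  hence "size A = card (set_mset A)"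
    by (simp add: size_multiset_overloaded_eq)
  moreover have "{x. poly p x = 0} = set_mset A"
    using roots by auto
  ultimately show ?thesis
    using A(1) by simp
qed

lemma CHAR_bit: "CHAR(bit) = 2"
  by (rule CHAR_eq_posI) (auto simp: less_2_cases_iff)

text \<open>The field with \<open>2 ^ m\<close> elements, as the fixed points of the
  \<open>m\<close>-fold Frobenius map. For \<open>m = 0\<close> it degenerates to the whole
  closure.\<close>

definition gf2 :: "nat \<Rightarrow> bit alg_closure set" where
  "gf2 m = {x. x ^ (2 ^ m) = x}"

lemma two_eq_0_bit_alg_closure: "(2 :: bit alg_closure) = 0"
  using of_nat_CHAR[where ?'a = "bit alg_closure"] by (simp add: CHAR_bit)

text \<open>The polynomial \<open>X ^ (2 ^ m) - X\<close> has derivative -1 in characteristic 2,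
  hence only simple roots.\<close>

lemma card_gf2:
  assumes "m > 0"
  shows "card (gf2 m) = 2 ^ m"
proof -
  let ?p = "monom 1 (2 ^ m) + [:0, -1:] :: bit alg_closure poly"
  have "(1::nat) < 2 ^ m"
    using assms by (intro one_less_power) auto
  hence deg: "degree ?p = 2 ^ m"
    by (subst degree_add_eq_left) (auto simp: degree_monom_eq)
  have "pderiv ?p = -1"
    using assms by (simp add: pderiv_add pderiv_monom pderiv_pCons two_eq_0_bit_alg_closure zero_power one_pCons)
  moreover have "?p \<noteq> 0"
    using deg by (metis degree_0 power_not_zero zero_neq_numeral)
  ultimately have "card {x. poly ?p x = 0} = degree ?p"
    by (intro card_roots_separable) auto
  thus ?thesis
    unfolding deg by (simp add: gf2_def poly_monom)
qed

lemma gf2_add: "x \<in> gf2 m \<Longrightarrow> y \<in> gf2 m \<Longrightarrow> x + y \<in> gf2 m"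
  by (simp add: gf2_def freshmans_dream'[of "2 ^ m" m] CHAR_bit)

lemma gf2_mult: "x \<in> gf2 m \<Longrightarrow> y \<in> gf2 m \<Longrightarrow> x * y \<in> gf2 m"
  by (simp add: gf2_def power_mult_distrib)

text \<open>\<open>e\<close> sends coordinates to linear combinations of a basis of
  \<open>gf2 m\<close> over \<open>bit\<close>. Independence gives injectivity, and equal
  cardinalities give surjectivity.\<close>

lemma exists_additive_bij_gf2:
  assumes "m > 0"
  obtains e :: "(nat \<Rightarrow> bit) \<Rightarrow> bit alg_closure"
  where "bij_betw e (fspace m) (gf2 m)" "\<And>x y. e (x + y) = e x + e y"
proof -
  define scale where "scale c x = to_ac c * x" for c :: bit and x
  interpret ac: vector_space scale
    by standard (auto simp: scale_def algebra_simps)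
  have sub: "ac.subspace (gf2 m)"
  proof -
    have "scale c x \<in> gf2 m" if "x \<in> gf2 m" for c x
      using that by (cases c) (auto simp: gf2_def scale_def)
    thus ?thesis
      by (auto simp: ac.subspace_def gf2_add) (simp add: gf2_def)
  qed
  have fin: "finite (gf2 m)"
    using card_gf2[OF assms] by (intro card_ge_0_finite) simp
  obtain B where B: "B \<subseteq> gf2 m" "ac.independent B" "gf2 m \<subseteq> ac.span B"
    by (rule ac.basis_exists[of "gf2 m"])
  have finB: "finite B"
    using B(1) fin by (rule finite_subset)
  have span: "ac.span B = gf2 m"
    using ac.span_minimal[OF B(1) sub] B(3) by (rule subset_antisym)
  \<comment> \<open>Counting the span yields the dimension \<open>m\<close> without naming a
    basis.\<close>
  have "2 ^ card B = (2::nat) ^ m"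
    using card_span[OF ac.vector_space_axioms finB B(2)] by (simp add: span card_gf2 assms card_bit)
  hence "card B = m"
    by simp
  then obtain b where b: "bij_betw b {..<m} B"
    using finB by (metis atLeast0LessThan ex_bij_betw_nat_finite)
  define e where "e x = (\<Sum>i<m. scale (x i) (b i))" for x
  have add: "e (x + y) = e x + e y" for x y
    by (simp add: e_def scale_def distrib_right sum.distrib)
  have "inj_on e (fspace m)"
  proof (rule inj_onI)
    fix x y :: "nat \<Rightarrow> bit"
    assume x: "x \<in> fspace m" and y: "y \<in> fspace m" and eq: "e x = e y"
    let ?b = "inv_into {..<m} b"
    have "(\<Sum>v\<in>B. scale (x (?b v) - y (?b v)) v) = (\<Sum>i<m. scale (x i - y i) (b i))"
      by (rule sum.reindex_bij_betw[OF b, symmetric, THEN trans])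
         (use b in \<open>auto simp: bij_betw_def intro!: sum.cong\<close>)
    also have "\<dots> = e x - e y"
      by (simp only: e_def scale_def sum_subtractf to_ac_diff left_diff_distrib)
    finally have "(\<Sum>v\<in>B. scale (x (?b v) - y (?b v)) v) = 0"
      using eq by simp
    hence zero: "x (?b v) - y (?b v) = 0" if "v \<in> B" for v
      by (rule ac.independentD[OF B(2) finB order_refl _ that, where u = "\<lambda>v. x (?b v) - y (?b v)"])
    show "x = y"
    proof
      fix i show "x i = y i"
      proof (cases "i < m")
        case True
        hence "b i \<in> B" "?b (b i) = i"
          using b by (auto simp: bij_betw_def)
        with zero[of "b i"] show ?thesis by (simp only: right_minus_eq)
      qed (use x y in \<open>auto simp: fspace_def\<close>)
    qed
  qed
  moreover have "e ` fspace m \<subseteq> gf2 m"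
    unfolding span[symmetric] e_def
    by (intro image_subsetI ac.span_sum ac.span_scale ac.span_base) (use bij_betwE[OF b] in auto)
  ultimately have "bij_betw e (fspace m) (gf2 m)"
    using fin by (simp add: bij_betw_def card_subset_eq card_image card_gf2 assms card_fspace card_bit)
  with add show thesis
    using that by blast
qed

text \<open>The multiplication of \<open>gf2 m\<close> is carried back along \<open>e\<close>; the
  last property is the absence of zero divisors.\<close>

lemma exists_fspace_mult:
  assumes "m > 0"
  obtains mul :: "(nat \<Rightarrow> bit) \<Rightarrow> (nat \<Rightarrow> bit) \<Rightarrow> (nat \<Rightarrow> bit)"
  where "\<And>a x. a \<in> fspace m \<Longrightarrow> x \<in> fspace m \<Longrightarrow> mul a x \<in> fspace m"
    "\<And>a b x. a \<in> fspace m \<Longrightarrow> b \<in> fspace m \<Longrightarrow> x \<in> fspace m \<Longrightarrow> mul (a + b) x = mul a x + mul b x"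
    "\<And>a x y. a \<in> fspace m \<Longrightarrow> x \<in> fspace m \<Longrightarrow> y \<in> fspace m \<Longrightarrow> mul a (x + y) = mul a x + mul a y"
    "\<And>a x. a \<in> fspace m \<Longrightarrow> x \<in> fspace m \<Longrightarrow> mul a x = 0 \<Longrightarrow> a = 0 \<or> x = 0"
proof -
  obtain e :: "(nat \<Rightarrow> bit) \<Rightarrow> bit alg_closure"
    where e: "bij_betw e (fspace m) (gf2 m)" and add: "\<And>x y. e (x + y) = e x + e y"
    using exists_additive_bij_gf2[OF assms] by blast
  define mul where "mul a x = inv_into (fspace m) e (e a * e x)" for a x
  have e_in: "e x \<in> gf2 m" if "x \<in> fspace m" for x
    using e that bij_betwE by blast
  have mul_in: "mul a x \<in> fspace m" and e_mul: "e (mul a x) = e a * e x"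
    if "a \<in> fspace m" "x \<in> fspace m" for a x
    using gf2_mult[OF e_in e_in, OF that] e
    by (auto simp: mul_def bij_betw_def inv_into_into f_inv_into_f)
  have sum_in: "x + y \<in> fspace m" if "x \<in> fspace m" "y \<in> fspace m" for x y :: "nat \<Rightarrow> bit"
    using fvec.subspace_add[OF subspace_fspace that] .
  have eqI: "x = y" if "e x = e y" "x \<in> fspace m" "y \<in> fspace m" for x y
    using e that by (auto simp: bij_betw_def dest: inj_onD)
  have "e 0 + e 0 = e 0 + 0"
    using add[of 0 0] by (simp only: add_0_right)
  hence 0: "0 \<in> fspace m" "e 0 = 0"
    by (simp_all only: add_left_cancel) (simp add: fspace_def)
  have mul_add_left: "mul (a + b) x = mul a x + mul b x"
    if "a \<in> fspace m" "b \<in> fspace m" "x \<in> fspace m" for a b x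
    by (rule eqI) (simp_all add: that e_mul add sum_in mul_in distrib_right)
  have mul_add_right: "mul a (x + y) = mul a x + mul a y"
    if "a \<in> fspace m" "x \<in> fspace m" "y \<in> fspace m" for a x y
    by (rule eqI) (simp_all add: that e_mul add sum_in mul_in distrib_left)
  have mul_eq_0: "a = 0 \<or> x = 0" if ax: "a \<in> fspace m" "x \<in> fspace m" "mul a x = 0" for a x
  proof -
    have "e a * e x = 0"
      using e_mul[OF ax(1,2)] 0(2) ax(3) by simp
    hence "e a = e 0 \<or> e x = e 0"
      using 0(2) by simp
    thus ?thesis
      using eqI[OF _ ax(1) 0(1)] eqI[OF _ ax(2) 0(1)] by blast
  qed
  show thesis
    by (rule that[OF mul_in mul_add_left mul_add_right mul_eq_0])
qed

subsection \<open>Lifted codes\<close>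

text \<open>\<open>T\<close> consists of \<open>S\<close>, placed in the first \<open>m\<close>
  coordinates, and one graph \<open>L a\<close> for each \<open>a\<close> in
  \<open>fspace m\<close>.\<close>

lemma partial_spread_lift:
  assumes S: "partial_spread m k (S :: (nat \<Rightarrow> bit) set set)" and km: "0 < k" "k \<le> m"
  obtains T :: "(nat \<Rightarrow> bit) set set"
  where "partial_spread (m + k) k T" "card T = 2 ^ m + card S"
proof -
  obtain mul :: "(nat \<Rightarrow> bit) \<Rightarrow> (nat \<Rightarrow> bit) \<Rightarrow> (nat \<Rightarrow> bit)"
    where mul_in: "\<And>a x. a \<in> fspace m \<Longrightarrow> x \<in> fspace m \<Longrightarrow> mul a x \<in> fspace m"
      and mul_add_left: "\<And>a b x. a \<in> fspace m \<Longrightarrow> b \<in> fspace m \<Longrightarrow> x \<in> fspace m \<Longrightarrow>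
        mul (a + b) x = mul a x + mul b x"
      and mul_add_right: "\<And>a x y. a \<in> fspace m \<Longrightarrow> x \<in> fspace m \<Longrightarrow> y \<in> fspace m \<Longrightarrow>
        mul a (x + y) = mul a x + mul a y"
      and mul_eq_0: "\<And>a x. a \<in> fspace m \<Longrightarrow> x \<in> fspace m \<Longrightarrow> mul a x = 0 \<Longrightarrow> a = 0 \<or> x = 0"
    using exists_fspace_mult[of m] km by auto
  define shift :: "(nat \<Rightarrow> bit) \<Rightarrow> nat \<Rightarrow> bit" where "shift x i = (if i < m then 0 else x (i - m))" for x i
  \<comment> \<open>\<open>f a x\<close> is the pair of \<open>mul a x\<close> and \<open>x\<close>,
    with \<open>x\<close> stored in the coordinates from \<open>m\<close> on.\<close>
  define f where "f a x = mul a x + shift x" for a x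
  have sub: "x \<in> fspace m" if "x \<in> fspace k" for x :: "nat \<Rightarrow> bit"
    using that fspace_mono[OF km(2)] by auto
  have sum_in: "x + y \<in> fspace n" if "x \<in> fspace n" "y \<in> fspace n" for x y :: "nat \<Rightarrow> bit" and n
    using fvec.subspace_add[OF subspace_fspace that] .
  have zero_in: "(0 :: nat \<Rightarrow> bit) \<in> fspace n" for n
    by (simp add: fspace_def)
  have shift_add: "shift (x + y) = shift x + shift y" for x y
    by (auto simp: shift_def fun_eq_iff)
  have f_high: "f a x (m + i) = x i" if "a \<in> fspace m" "x \<in> fspace k" for a x i
    using mul_in[OF that(1) sub[OF that(2)]] by (simp add: f_def shift_def fspace_def)
  have f_in: "f a x \<in> fspace (m + k)" if "a \<in> fspace m" "x \<in> fspace k" for a x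
    unfolding f_def
    by (rule sum_in) (use mul_in[OF that(1) sub[OF that(2)]] that(2) in \<open>auto simp: shift_def fspace_def\<close>)
  have f_add: "f a (x + y) = f a x + f a y" if "a \<in> fspace m" "x \<in> fspace k" "y \<in> fspace k" for a x y
    using that by (simp add: f_def mul_add_right sub shift_add algebra_simps)
  have f_inj: "x = y" if "f a x = f b y" "a \<in> fspace m" "b \<in> fspace m" "x \<in> fspace k" "y \<in> fspace k"
    for a b x y
    using that f_high by (metis ext)
  have f_0: "f a 0 = 0" if "a \<in> fspace m" for a
    using f_add[OF that zero_in zero_in] by simp
  define L where "L a = f a ` fspace k" for a
  have sub_L: "fvec.subspace (L a)" if "a \<in> fspace m" for a
    unfolding subspace_bit_iff
  proof (intro conjI ballI)
    show "0 \<in> L a"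
      unfolding L_def using f_0[OF that] zero_in by (metis imageI)
    fix u v assume "u \<in> L a" "v \<in> L a"
    then obtain x y where "x \<in> fspace k" "y \<in> fspace k" "u = f a x" "v = f a y"
      by (auto simp: L_def)
    thus "u + v \<in> L a"
      unfolding L_def using f_add[OF that] sum_in by (metis imageI)
  qed
  have card_L: "card (L a) = 2 ^ k" if "a \<in> fspace m" for a
    unfolding L_def using f_inj[OF _ that that]
    by (subst card_image) (auto intro!: inj_onI simp: card_fspace card_bit)
  have dim_L: "fvec.dim (L a) = k" if "a \<in> fspace m" for a
  proof -
    have "finite (L a)"
      unfolding L_def by (rule finite_imageI[OF finite_fspace])
    thus ?thesis
      using card_subspace[OF sub_L[OF that]] card_L[OF that] by (simp add: card_bit)
  qed
  have L_disj: "L a \<inter> L b = {0}" if ab: "a \<in> fspace m" "b \<in> fspace m" "a \<noteq> b" for a b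
  proof -
    have "u = 0" if u: "u \<in> L a" "u \<in> L b" for u
    proof -
      obtain x y where x: "x \<in> fspace k" "u = f a x" and y: "y \<in> fspace k" "u = f b y"
        using u by (auto simp: L_def)
      hence "x = y"
        using f_inj ab by metis
      hence "mul a x = mul b x"
        using x y by (simp add: f_def)
      \<comment> \<open>In characteristic 2 the sum \<open>a + b\<close> is also the difference,
        hence nonzero for \<open>a \<noteq> b\<close>.\<close>
      hence "mul (a + b) x = 0"
        using mul_add_left[OF ab(1,2) sub[OF x(1)]] by (simp add: fvec_bit_add_self)
      hence "a + b = 0 \<or> x = 0"
        using mul_eq_0[OF sum_in[OF ab(1,2)] sub[OF x(1)]] by blast
      moreover have "a + b \<noteq> 0"
        using ab(3) fvec_bit_add_self[of b] by (metis add_right_cancel)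
      ultimately show "u = 0"
        using x f_0[OF ab(1)] by simp
    qed
    moreover have "0 \<in> L a" "0 \<in> L b"
      using sub_L ab by (auto simp: subspace_bit_iff)
    ultimately show ?thesis
      by auto
  qed
  have L_fspace: "L a \<inter> Y = {0}" if a: "a \<in> fspace m" and Y: "fvec.subspace Y" "Y \<subseteq> fspace m" for a Y
  proof -
    have "u = 0" if u: "u \<in> L a" "u \<in> Y" for u
    proof -
      obtain x where x: "x \<in> fspace k" "u = f a x"
        using u by (auto simp: L_def)
      \<comment> \<open>\<open>u\<close> lies in \<open>fspace m\<close>, so its coordinates from
        \<open>m\<close> on vanish, and these are \<open>x\<close>.\<close>
      have "x i = 0" for i
        using f_high[OF a x(1), of i] u(2) Y(2) x(2) by (auto simp: fspace_def)
      hence "x = 0"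
        by auto
      thus "u = 0"
        using x f_0[OF a] by simp
    qed
    moreover have "0 \<in> L a" "0 \<in> Y"
      using sub_L[OF a] Y by (auto simp: subspace_bit_iff)
    ultimately show ?thesis
      by auto
  qed
  \<comment> \<open>Trivial intersection separates only sets other than \<open>{0}\<close>. With
    \<open>k > 0\<close> this makes \<open>L\<close> injective and keeps its values out of
    \<open>S\<close>, so the count of \<open>?T\<close> is exact.\<close>
  have L_nontrivial: "L a \<noteq> {0}" if "a \<in> fspace m" for a
  proof
    assume "L a = {0}"
    hence "(2::nat) ^ k = 1"
      using card_L[OF that] by simp
    thus False
      using km(1) one_less_power[of "2::nat" k] by simp
  qed
  have L_notin: "L a \<notin> S" if "a \<in> fspace m" for a
    using L_fspace[OF that, of "L a"] L_nontrivial[OF that] S by (auto simp: partial_spread_def)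
  let ?T = "L ` fspace m \<union> S"
  have "inj_on L (fspace m)"
  proof (rule inj_onI, rule ccontr)
    fix a b :: "nat \<Rightarrow> bit"
    assume ab: "a \<in> fspace m" "b \<in> fspace m" "L a = L b" "a \<noteq> b"
    from L_disj[OF ab(1,2,4)] L_nontrivial[OF ab(1)] ab(3) show False
      by simp
  qed
  hence "card (L ` fspace m) = 2 ^ m"
    by (simp add: card_image card_fspace card_bit)
  hence "card ?T = 2 ^ m + card S"
    using L_notin finite_partial_spread[OF S] finite_fspace by (subst card_Un_disjoint) auto
  moreover have "partial_spread (m + k) k ?T"
    unfolding partial_spread_def
  proof (intro conjI ballI impI)
    fix U assume U: "U \<in> ?T"
    show "fvec.subspace U" "fvec.dim U = k"
      using U sub_L dim_L S by (auto simp: partial_spread_def)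
    show "U \<subseteq> fspace (m + k)"
      using U
    proof
      assume "U \<in> S"
      thus ?thesis
        using S fspace_mono[of m "m + k"] unfolding partial_spread_def by (meson le_add1 order_trans)
    qed (use f_in in \<open>auto simp: L_def\<close>)
    fix W assume W: "W \<in> ?T" "U \<noteq> W"
    have L_S: "L a \<inter> Y = {0}" if "a \<in> fspace m" "Y \<in> S" for a Y
      using L_fspace S that by (simp add: partial_spread_def)
    have S_S: "Y \<inter> Z = {0}" if "Y \<in> S" "Z \<in> S" "Y \<noteq> Z" for Y Z
      using S that by (simp add: partial_spread_def)
    consider a b where "a \<in> fspace m" "b \<in> fspace m" "U = L a" "W = L b"
      | a where "a \<in> fspace m" "U = L a" "W \<in> S"
      | a where "a \<in> fspace m" "W = L a" "U \<in> S"
      | "U \<in> S" "W \<in> S"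
      using U W(1) by auto
    thus "U \<inter> W = {0}"
    proof cases
      case 1
      with W(2) L_disj[of a b] show ?thesis
        by blast
    next
      case 2
      with L_S show ?thesis
        by simp
    next
      case 3
      with L_S[of a U] show ?thesis
        by (simp add: inf_commute)
    next
      case 4
      with S_S W(2) show ?thesis
        by simp
    qed
  qed
  ultimately show thesis
    using that by blast
qed

text \<open>A single subspace starts the induction, and each lift enlarges the ambient dimension by
  \<open>k\<close>.\<close>

lemma exists_partial_spread:
  assumes "k > 0"
  shows "\<exists>S :: (nat \<Rightarrow> bit) set set. partial_spread (k * (t + 1) + 2) k S \<and> card S = spread_size k t"
proof (induction t)
  case 0
  have "partial_spread (k * (0 + 1) + 2) k {fspace k :: (nat \<Rightarrow> bit) set}"
    using fspace_mono[of k "k + 2"] by (auto simp: partial_spread_def subspace_fspace dim_fspace)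
  thus ?case
    by (intro exI[of _ "{fspace k}"]) simp
next
  case (Suc t)
  then obtain S :: "(nat \<Rightarrow> bit) set set"
    where S: "partial_spread (k * (t + 1) + 2) k S" "card S = spread_size k t"
    by blast
  have "k * (t + 1) + 2 + k = k * (Suc t + 1) + 2" "k \<le> k * (t + 1) + 2"
    by simp_all
  with partial_spread_lift[OF S(1) assms] S(2) show ?case
    by (metis Suc_eq_plus1 spread_size.simps(2))
qed

theorem theorem14:
  fixes t k :: nat
  assumes "t \<ge> 1" and "k \<ge> 4"
  shows "real (max_partial_spread TYPE(bit) (k * (t + 1) + 2) k) =
    (2 ^ (k * (t + 1) + 2) - 3 * 2 ^ k - 1) / (2 ^ k - 1)"
proof -
  have "max_partial_spread TYPE(bit) (k * (t + 1) + 2) k = spread_size k t"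
    unfolding max_partial_spread_def
  proof (rule Max_eqI[OF finite_partial_spreads])
    show "spread_size k t \<in> {card S |S :: (nat \<Rightarrow> bit) set set. partial_spread (k * (t + 1) + 2) k S}"
      using exists_partial_spread[of k t] assms(2) by force
  qed (use partial_spread_le assms(2) in blast)
  moreover have "real (spread_size k t) * 2 ^ k + 3 * 2 ^ k + 1 = 2 ^ (k * (t + 1) + 2) + real (spread_size k t)"
    using arg_cong[OF spread_size_eq[of k t], of real] by simp
  moreover have "(2::real) ^ k > 1"
    using assms(2) by (intro one_less_power) auto
  ultimately show ?thesis
    by (simp add: field_simps)
qed

end
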